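(* Let $(X,\varrho)$ be a metric space, $H\subset X$ a closed set, $Z$ a normed linear space and $f\colon H\to Z$ a Baire one function. Then there exists a continuous function $g\colon X\setminus H\to Z$ such that all of the following hold: (NT) for every $a\in\partial H$, $$\lim_{\substack{x\to a\\ x\in X\setminus H}} \|g(x)-f(a)\|_Z\,\frac{\operatorname{dist}(x,H)}{\varrho(x,a)}=0;$$ (C) whenever $a\in\partial H$ and $f$ is continuous at $a$ (as a function on $H$), $$\lim_{\substack{x\to a\\ x\in X\setminus H}} g(x)=f(a);$$ (B) whenever $a\in H$, $r\in(0,\infty)\cup\{\infty\}$ and $f$ is bounded on $B(a,12r)\cap H$, the function $g$ is bounded on $B(a,r)\setminus H$.
   Context: A function $f\colon H\to Z$ is Baire one if it is the pointwise limit of a sequence of continuous functions $H\to Z$. $\partial H$ denotes the topological boundary of $H$ in $X$. $B(a,r)=\{x\in X: \varrho(a,x)<r\}$ is the open ball; for $r=\infty$ we have $12r=\infty$ and $B(a,\infty)=X$. $\operatorname{dist}(x,H)=\inf_{y\in H}\varrho(x,y)$. $\|\cdot\|_Z$ is the norm of $Z$ ($Z$ is not assumed complete). *)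

theory Defs
  imports "HOL-Analysis.Analysis"
begin

text \<open>Functions \<open>H \<rightarrow> Z\<close> are represented by total functions of which only
  the values on \<open>H\<close> matter.\<close>

definition baire_one_on :: "'a::topological_space set \<Rightarrow> ('a \<Rightarrow> 'b::topological_space) \<Rightarrow> bool" where
  "baire_one_on H f \<longleftrightarrow>
     (\<exists>F :: nat \<Rightarrow> 'a \<Rightarrow> 'b. (\<forall>n. continuous_on H (F n)) \<and>
        (\<forall>x\<in>H. (\<lambda>n. F n x) \<longlonglongrightarrow> f x))"

end

theory Submission
  imports Defs
begin

text \<open>
  Write \<open>d(x)\<close> for the distance of \<open>x\<close> to \<open>H\<close>. The function \<open>g\<close> is built in two
  independent steps: a choice of values \<open>u y d\<close>, attached to a point \<open>y \<in> H\<close> and a scale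
  \<open>d > 0\<close> with no continuity in either argument, and an averaging procedure that turns these
  values into a continuous function off \<open>H\<close>. Near \<open>x\<close> the average only uses values \<open>u y d\<close>
  whose \<open>d\<close> is comparable to \<open>d(x)\<close> and whose \<open>y\<close> is within \<open>3 d(x)\<close> of \<open>x\<close>
  (\<open>whitney_average\<close>), so every estimate on \<open>g\<close> reduces to one on \<open>u\<close>.

  Let \<open>F n \<rightarrow> f\<close> with \<open>F n\<close> continuous. The value \<open>u y d\<close> is \<open>F n y\<close> for the greatest
  \<open>n \<le> 1/d\<close> such that \<open>F n\<close> varies by at most \<open>1/(n+1)\<close> around \<open>y\<close> on the scale
  \<open>sqrt d\<close>, with two corrections. If \<open>F n y\<close> is further from \<open>f y\<close> than twice the variation of
  \<open>f\<close> around \<open>y\<close> on that scale, it is replaced by \<open>f y\<close>; a value of norm above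
  \<open>1/sqrt (sqrt d)\<close> is replaced by \<open>0\<close>. The resulting properties
  (\<open>baire_one_scale_approximation\<close>) yield the three claims as follows.

  For the nontangential limit, consider a value \<open>u y d\<close> used at \<open>x\<close>. If \<open>y\<close> is within
  \<open>sqrt d\<close> of \<open>a\<close>, then \<open>u y d\<close> is close to \<open>f a\<close>: any fixed \<open>F m\<close> passes the
  test on variation once \<open>d\<close> is small, so the selected index tends to infinity, and \<open>F n y\<close>
  may be compared with \<open>F n a\<close>. Otherwise \<open>x\<close> approaches \<open>a\<close> so tangentially that
  \<open>d(x) / dist x a\<close> is \<open>O(sqrt d)\<close>, which beats the norm bound \<open>1/sqrt (sqrt d)\<close>.
  Continuity of \<open>f\<close> at \<open>a\<close>, or boundedness of \<open>f\<close> near \<open>a\<close>, passes to \<open>u\<close> because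
  the correction by \<open>f y\<close> keeps \<open>u y d\<close> within the range of variation of \<open>f\<close> near
  \<open>y\<close>.

  The averaging needs locally finite partitions of unity in a metric space that need not be
  separable, with values in a space that need not be complete. They come from Stone's
  \<open>\<sigma>\<close>-discrete refinement of an open cover (\<open>sigma_discrete_refinement\<close>) and a
  modification of countably many weights that makes them locally finite
  (\<open>locally_finite_weights\<close>).
\<close>

section \<open>Continuous averages subordinate to an open cover\<close>

lemma infdist_lessE:
  assumes "infdist x A < d" "A \<noteq> {}"
  obtains a where "a \<in> A" "dist x a < d"
proof -
  have "\<exists>a\<in>A. dist x a < d"
  proof (rule ccontr)
    assume "\<not> ?thesis"
    then have "d \<le> infdist x A"
      unfolding infdist_notempty[OF assms(2)] by (intro cINF_greatest assms(2)) auto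
    then show False using assms(1) by simp
  qed
  then show thesis using that by blast
qed

text \<open>
  Subtracting \<open>n\<close> times the sum of the previous weights from \<open>p n\<close> switches off all late
  weights wherever an early one is bounded below, while the first positive weight at a point
  survives unchanged.
\<close>

lemma locally_finite_weights:
  fixes p :: "nat \<Rightarrow> 'a::t2_space \<Rightarrow> real"
  assumes cont: "\<And>n. continuous_on UNIV (p n)"
    and nonneg: "\<And>n x. 0 \<le> p n x" and le1: "\<And>n x. p n x \<le> 1"
  obtains q :: "nat \<Rightarrow> 'a \<Rightarrow> real"
  where "\<And>n. continuous_on UNIV (q n)" "\<And>n x. 0 \<le> q n x"
    "\<And>n x. q n x \<noteq> 0 \<Longrightarrow> p n x > 0"
    "\<And>k x. p k x > 0 \<Longrightarrow> \<exists>n. q n x > 0"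
    "\<And>k x. p k x > 0 \<Longrightarrow> \<exists>N. eventually (\<lambda>y. \<forall>n\<ge>N. q n y = 0) (nhds x)"
proof
  let ?q = "\<lambda>n x. max 0 (p n x - real n * (\<Sum>k<n. p k x))"
  show "continuous_on UNIV (?q n)" for n
    by (intro continuous_intros cont)
  show "0 \<le> ?q n x" for n x by simp
  show "p n x > 0" if "?q n x \<noteq> 0" for n x
  proof -
    have "0 \<le> real n * (\<Sum>k<n. p k x)" by (intro mult_nonneg_nonneg sum_nonneg nonneg) simp
    with that show ?thesis by (auto simp: max_def split: if_splits)
  qed
  show "\<exists>n. ?q n x > 0" if "p k x > 0" for k x
  proof -
    define n where "n = (LEAST n. p n x > 0)"
    have "p n x > 0" unfolding n_def using that by (rule LeastI)
    moreover have "p j x = 0" if "j < n" for j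
      using not_less_Least[OF that[unfolded n_def]] nonneg[of j x] by simp
    ultimately have "?q n x > 0" by simp
    then show ?thesis ..
  qed
  show "\<exists>N. eventually (\<lambda>y. \<forall>n\<ge>N. ?q n y = 0) (nhds x)" if pos: "p k x > 0" for k x
  proof -
    define e where "e = p k x / 2"
    have e: "0 < e" "e < p k x" using pos by (auto simp: e_def)
    obtain m :: nat where m: "1 / e < m" using reals_Archimedean2 by blast
    have "isCont (p k) x" using cont by (simp add: continuous_on_eq_continuous_at)
    then have "(p k \<longlongrightarrow> p k x) (nhds x)"
      by (simp add: isCont_def tendsto_at_iff_tendsto_nhds)
    then have "eventually (\<lambda>y. e < p k y) (nhds x)"
      using e(2) by (rule order_tendstoD)
    then have "eventually (\<lambda>y. \<forall>n\<ge>max m (Suc k). ?q n y = 0) (nhds x)"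
    proof eventually_elim
      case (elim y)
      show ?case
      proof (intro allI impI)
        fix n assume n: "max m (Suc k) \<le> n"
        have "p k y \<le> (\<Sum>k<n. p k y)"
          using n nonneg by (intro member_le_sum[where f = "\<lambda>k. p k y"]) auto
        then have "e \<le> (\<Sum>k<n. p k y)" using elim by linarith
        moreover have "1 / e \<le> real n" using n m by linarith
        ultimately have "1 / e * e \<le> real n * (\<Sum>k<n. p k y)"
          using e by (intro mult_mono) auto
        then show "?q n y = 0" using e le1[of n y] by (simp add: max_def)
      qed
    qed
    then show ?thesis by blast
  qed
qed

text \<open>
  This is the core of Stone's theorem that metric spaces are paracompact. Well-order the
  indices and let \<open>T n i\<close> consist of the points whose \<open>1/(n+1)\<close>-ball lies in \<open>U i\<close> and
  that belong to no earlier \<open>U j\<close>. Of two points from different \<open>T n i\<close>, \<open>T n j\<close>, the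
  one with the later index avoids the ball around the other, so for each \<open>n\<close> the pieces are
  uniformly separated.
\<close>

lemma sigma_discrete_refinement:
  fixes U :: "'i \<Rightarrow> 'a::metric_space set"
  assumes "\<And>i. open (U i)"
  obtains T :: "nat \<Rightarrow> 'i \<Rightarrow> 'a set"
  where "\<And>n i x. x \<in> T n i \<Longrightarrow> ball x (1 / Suc n) \<subseteq> U i"
    "\<And>n i j x y. x \<in> T n i \<Longrightarrow> y \<in> T n j \<Longrightarrow> dist x y < 1 / Suc n \<Longrightarrow> i = j"
    "(\<Union>i. U i) = (\<Union>n. \<Union>i. T n i)"
proof -
  obtain r :: "'i rel" where "well_order_on UNIV r" using well_order_on by blast
  then have wf: "wf (r - Id)" and tot: "\<And>i j. i \<noteq> j \<Longrightarrow> (i, j) \<in> r - Id \<or> (j, i) \<in> r - Id"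
    by (auto simp: well_order_on_def linear_order_on_def total_on_def)
  define T where "T n i = {x. ball x (1 / Suc n) \<subseteq> U i \<and> (\<forall>j. (j, i) \<in> r - Id \<longrightarrow> x \<notin> U j)}"
    for n i
  have sub: "ball x (1 / Suc n) \<subseteq> U i" if "x \<in> T n i" for n i x
    using that by (simp add: T_def)
  have wlog: False if "x \<in> T n i" "y \<in> T n j" "dist x y < 1 / Suc n" "(i, j) \<in> r - Id" for n i j x y
  proof -
    have "y \<in> U i" using sub[OF that(1)] that(3) by auto
    then show False using that(2,4) by (auto simp: T_def)
  qed
  show thesis
  proof (rule that[of T])
    show "ball x (1 / Suc n) \<subseteq> U i" if "x \<in> T n i" for n i x
      by (rule sub[OF that])
    show "i = j" if "x \<in> T n i" "y \<in> T n j" "dist x y < 1 / Suc n" for n i j x y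
      using wlog[OF that] wlog[OF that(2,1)] that(3) tot by (metis dist_commute)
    show "(\<Union>i. U i) = (\<Union>n. \<Union>i. T n i)"
    proof
      show "(\<Union>n. \<Union>i. T n i) \<subseteq> (\<Union>i. U i)"
        using sub by (fastforce intro: centre_in_ball[THEN iffD2])
      show "(\<Union>i. U i) \<subseteq> (\<Union>n. \<Union>i. T n i)"
      proof
        fix x assume "x \<in> (\<Union>i. U i)"
        then obtain i0 where i0: "i0 \<in> {i. x \<in> U i}" by blast
        \<comment> \<open>The first member of the cover that contains \<open>x\<close>.\<close>
        obtain i where "i \<in> {i. x \<in> U i}" "\<And>j. (j, i) \<in> r - Id \<Longrightarrow> j \<notin> {i. x \<in> U i}"
          using wf[unfolded wf_eq_minimal, rule_format, OF i0] by auto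
        then have i: "x \<in> U i" "\<And>j. (j, i) \<in> r - Id \<Longrightarrow> x \<notin> U j"
          by blast+
        obtain e where e: "e > 0" "ball x e \<subseteq> U i"
          using assms i(1) by (meson open_contains_ball)
        obtain n where "1 / Suc n < e" using e(1) nat_approx_posE by blast
        then have "ball x (1 / Suc n) \<subseteq> U i" using e(2) by force
        then have "x \<in> T n i" using i(2) by (simp add: T_def)
        then show "x \<in> (\<Union>n. \<Union>i. T n i)" by blast
      qed
    qed
  qed
qed

text \<open>
  On level \<open>n\<close> the neighbourhoods of radius \<open>1/(3(n+1))\<close> of the pieces \<open>T n i\<close> are
  disjoint and even separated, so a single weight \<open>p n\<close> per level suffices: where it is
  positive, the index \<open>i\<close> of the nearby piece is determined and locally constant. This leaves
  a countable family of weights, to which \<open>locally_finite_weights\<close> applies.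
\<close>

lemma continuous_average:
  fixes U :: "'i \<Rightarrow> 'a::metric_space set" and c :: "'i \<Rightarrow> 'z::real_normed_vector"
  assumes "\<And>i. open (U i)"
  obtains g :: "'a \<Rightarrow> 'z"
  where "continuous_on (\<Union>i. U i) g"
    "\<And>x. x \<in> (\<Union>i. U i) \<Longrightarrow> g x \<in> convex hull (c ` {i. x \<in> U i})"
proof -
  obtain T :: "nat \<Rightarrow> 'i \<Rightarrow> 'a set" where
    T_sub: "\<And>n i x. x \<in> T n i \<Longrightarrow> ball x (1 / Suc n) \<subseteq> U i" and
    T_disj: "\<And>n i j x y. x \<in> T n i \<Longrightarrow> y \<in> T n j \<Longrightarrow> dist x y < 1 / Suc n \<Longrightarrow> i = j" and
    T_cover: "(\<Union>i. U i) = (\<Union>n. \<Union>i. T n i)"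
    using sigma_discrete_refinement[of U, OF assms] by blast
  define D where "D n = (\<Union>i. T n i)" for n
  \<comment> \<open>The distance to the empty set is \<open>0\<close> by convention, which would give weight \<open>1\<close>.\<close>
  define p where "p n x = (if D n = {} then 0 else max 0 (1 - 3 * Suc n * infdist x (D n)))" for n x
  have p_cont: "continuous_on UNIV (p n)" for n
  proof (cases "D n = {}")
    case False
    then show ?thesis unfolding p_def by (simp, intro continuous_intros)
  qed (simp add: p_def)
  have p01: "0 \<le> p n x" "p n x \<le> 1" for n x
    by (auto simp: p_def infdist_nonneg)
  have p_pos: "\<exists>n. p n x > 0" if "x \<in> (\<Union>i. U i)" for x
  proof -
    obtain n where "x \<in> D n" using \<open>x \<in> _\<close> T_cover by (auto simp: D_def)
    then have "p n x > 0" by (auto simp: p_def)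
    then show ?thesis ..
  qed
  obtain q :: "nat \<Rightarrow> 'a \<Rightarrow> real" where
    q_cont: "\<And>n. continuous_on UNIV (q n)" and q_nonneg: "\<And>n x. 0 \<le> q n x" and
    q_p: "\<And>n x. q n x \<noteq> 0 \<Longrightarrow> p n x > 0" and
    q_pos: "\<And>k x. p k x > 0 \<Longrightarrow> \<exists>n. q n x > 0" and
    q_fin: "\<And>k x. p k x > 0 \<Longrightarrow> \<exists>N. eventually (\<lambda>y. \<forall>n\<ge>N. q n y = 0) (nhds x)"
    using locally_finite_weights[of p, OF p_cont p01] by blast

  define near where "near n x i \<longleftrightarrow> (\<exists>t\<in>T n i. dist x t < 1 / (3 * Suc n))" for n x i
  have near_ex: "\<exists>i. near n x i" if "q n x \<noteq> 0" for n x
  proof -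
    have "D n \<noteq> {}" "3 * Suc n * infdist x (D n) < 1"
      using q_p[OF that] by (auto simp: p_def split: if_splits)
    then have "infdist x (D n) < 1 / (3 * Suc n)"
      by (simp add: field_simps)
    then obtain t where "t \<in> D n" "dist x t < 1 / (3 * Suc n)"
      using \<open>D n \<noteq> {}\<close> by (rule infdist_lessE)
    then show ?thesis by (auto simp: near_def D_def)
  qed
  have near_unique: "i = j" if nxy: "near n x i" "near n y j" and dxy: "dist x y < 1 / (3 * Suc n)" for n x y i j
  proof -
    obtain s t where st: "s \<in> T n i" "dist x s < 1 / (3 * Suc n)"
        "t \<in> T n j" "dist y t < 1 / (3 * Suc n)"
      using nxy unfolding near_def by blast
    have "dist s t \<le> dist x s + dist x y + dist y t"
      using dist_triangle[of s t x] dist_triangle[of x t y] by (simp add: dist_commute)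
    also have "\<dots> < 3 * (1 / (3 * Suc n))" using st dxy by linarith
    also have "\<dots> = 1 / Suc n" by (simp add: field_simps)
    finally show ?thesis using T_disj st by blast
  qed
  have near_U: "x \<in> U i" if "near n x i" for n x i
  proof -
    obtain t where t: "t \<in> T n i" "dist x t < 1 / (3 * Suc n)"
      using \<open>near n x i\<close> unfolding near_def by blast
    have "1 / (3 * real (Suc n)) \<le> 1 / Suc n" by (simp add: field_simps)
    then show ?thesis using T_sub[OF t(1)] t(2) by (auto simp: dist_commute)
  qed
  define \<iota> where "\<iota> n x = (SOME i. near n x i)" for n x
  have near_\<iota>: "near n x (\<iota> n x)" if "q n x \<noteq> 0" for n x
    unfolding \<iota>_def using near_ex[OF that] by (rule someI_ex)
  \<comment> \<open>Although \<open>\<iota> n\<close> jumps, on a small ball it takes one value wherever \<open>q n\<close> does not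
    vanish, so there the product agrees with \<open>q n\<close> times a constant vector.\<close>
  have qc_cont: "isCont (\<lambda>x. q n x *\<^sub>R c (\<iota> n x)) x" for n x
  proof -
    have "eventually (\<lambda>y. dist y x < 1 / (6 * Suc n)) (nhds x)"
      by (rule eventually_nhds_in_open[THEN eventually_mono, of "ball x (1 / (6 * Suc n))"])
         (auto simp: dist_commute)
    moreover have "\<exists>i. \<forall>y. dist y x < 1 / (6 * Suc n) \<longrightarrow> q n y \<noteq> 0 \<longrightarrow> \<iota> n y = i"
    proof (rule ccontr)
      assume "\<not> ?thesis"
      then obtain y z where yz: "dist y x < 1 / (6 * Suc n)" "q n y \<noteq> 0"
        "dist z x < 1 / (6 * Suc n)" "q n z \<noteq> 0" "\<iota> n y \<noteq> \<iota> n z"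
        by metis
      have "dist y z < 1 / (6 * Suc n) + 1 / (6 * Suc n)"
        using dist_triangle2[of y z x] yz by linarith
      also have "\<dots> = 1 / (3 * Suc n)" by (simp add: field_simps)
      finally show False using near_unique near_\<iota> yz by blast
    qed
    ultimately obtain i where
      "eventually (\<lambda>y. q n y *\<^sub>R c (\<iota> n y) = q n y *\<^sub>R c i) (nhds x)"
      by (smt (verit) eventually_mono scaleR_eq_0_iff)
    moreover have "isCont (\<lambda>y. q n y *\<^sub>R c i) x"
      using q_cont[of n] by (intro continuous_intros) (simp add: continuous_on_eq_continuous_at)
    ultimately show ?thesis by (rule isCont_cong[THEN iffD2])
  qed
  define A where "A x = {n. q n x \<noteq> 0}" for x
  define Q where "Q x = (\<Sum>n\<in>A x. q n x)" for x
  define g where "g x = (\<Sum>n\<in>A x. (q n x / Q x) *\<^sub>R c (\<iota> n x))" for x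
  have local: "\<exists>N. eventually (\<lambda>y. A y \<subseteq> {..<N}) (nhds x)" if x: "x \<in> (\<Union>i. U i)" for x
  proof -
    obtain N where N: "eventually (\<lambda>y. \<forall>n\<ge>N. q n y = 0) (nhds x)"
      using p_pos[OF x] q_fin by blast
    have "eventually (\<lambda>y. A y \<subseteq> {..<N}) (nhds x)"
      using N by eventually_elim (auto simp: A_def not_le[symmetric])
    then show ?thesis ..
  qed
  have finA: "finite (A x)" if "x \<in> (\<Union>i. U i)" for x
    using local[OF that] eventually_nhds_x_imp_x finite_subset by blast
  have Qpos: "Q x > 0" if x: "x \<in> (\<Union>i. U i)" for x
  proof -
    obtain n where "q n x > 0" using p_pos[OF x] q_pos by blast
    then show ?thesis unfolding Q_def
      by (intro sum_pos2[of _ n] finA[OF x]) (auto simp: A_def q_nonneg)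
  qed
  have "isCont g x" if x: "x \<in> (\<Union>i. U i)" for x
  proof -
    obtain N where N: "eventually (\<lambda>y. A y \<subseteq> {..<N}) (nhds x)" using local[OF x] by blast
    let ?Q = "\<lambda>y. \<Sum>n<N. q n y"
    let ?g = "\<lambda>y. (1 / ?Q y) *\<^sub>R (\<Sum>n<N. q n y *\<^sub>R c (\<iota> n y))"
    have eq: "eventually (\<lambda>y. Q y = ?Q y \<and> g y = ?g y) (nhds x)"
      using N
    proof eventually_elim
      case (elim y)
      have 1: "Q y = ?Q y" unfolding Q_def
        by (rule sum.mono_neutral_left) (use elim in \<open>auto simp: A_def\<close>)
      have "g y = (\<Sum>n<N. (q n y / Q y) *\<^sub>R c (\<iota> n y))" unfolding g_def
        by (rule sum.mono_neutral_left) (use elim in \<open>auto simp: A_def\<close>)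
      also have "\<dots> = ?g y" by (simp add: 1 scaleR_sum_right)
      finally show ?case using 1 by simp
    qed
    have "?Q x \<noteq> 0" using eventually_nhds_x_imp_x[OF eq] Qpos[OF x] by simp
    then have "isCont ?g x"
      using q_cont by (intro continuous_intros qc_cont) (auto simp: continuous_on_eq_continuous_at)
    moreover have "eventually (\<lambda>y. g y = ?g y) (nhds x)" using eq by eventually_elim simp
    then have "isCont g x \<longleftrightarrow> isCont ?g x" by (rule isCont_cong)
    ultimately show ?thesis by blast
  qed
  then have "continuous_on (\<Union>i. U i) g" by (simp add: continuous_at_imp_continuous_on)
  moreover have "g x \<in> convex hull (c ` {i. x \<in> U i})" if x: "x \<in> (\<Union>i. U i)" for x
    unfolding g_def
  proof (rule convex_sum)
    show "(\<Sum>n\<in>A x. q n x / Q x) = 1"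
      using Qpos[OF x] by (simp add: Q_def flip: sum_divide_distrib)
    show "c (\<iota> n x) \<in> convex hull c ` {i. x \<in> U i}" if "n \<in> A x" for n
      using near_U[OF near_\<iota>] that by (intro hull_inc) (auto simp: A_def)
  qed (use finA[OF x] Qpos[OF x] q_nonneg in \<open>auto intro: divide_nonneg_pos\<close>)
  ultimately show thesis by (rule that)
qed

section \<open>Boundary data at positive scales\<close>

text \<open>
  The first property serves the points at which \<open>y\<close> is too far from \<open>a\<close> to be compared with
  it, the second is convergence to \<open>f a\<close> at every \<open>a \<in> H\<close>, and the third says that \<open>u y d\<close>
  stays near any centre \<open>b\<close> near which \<open>f\<close> stays; it is applied with \<open>b = f a\<close> for
  continuity and \<open>b = 0\<close> for boundedness. The factor \<open>5\<close> arises as \<open>f y\<close> is within \<open>M\<close> of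
  \<open>b\<close>, and \<open>u y d\<close> is within twice a variation of at most \<open>2 * M\<close> of \<open>f y\<close>; the last premise
  keeps the truncation from interfering.
\<close>

lemma baire_one_scale_approximation:
  fixes H :: "'a::metric_space set" and f :: "'a \<Rightarrow> 'z::real_normed_vector"
  assumes "baire_one_on H f"
  obtains u :: "'a \<Rightarrow> real \<Rightarrow> 'z"
  where "\<And>y d. d > 0 \<Longrightarrow> norm (u y d) \<le> 1 / sqrt (sqrt d)"
    "\<And>a e. a \<in> H \<Longrightarrow> e > 0 \<Longrightarrow>
       eventually (\<lambda>d. \<forall>y\<in>H. dist y a \<le> sqrt d \<longrightarrow> norm (u y d - f a) \<le> e) (at_right 0)"
    "\<And>y d b M. y \<in> H \<Longrightarrow> d > 0 \<Longrightarrow>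
       \<forall>z\<in>H. dist y z \<le> sqrt d \<longrightarrow> norm (f z - b) \<le> M \<Longrightarrow>
       5 * M + norm b \<le> 1 / sqrt (sqrt d) \<Longrightarrow> norm (u y d - b) \<le> 5 * M"
proof -
  obtain F :: "nat \<Rightarrow> 'a \<Rightarrow> 'z" where
    F_cont: "\<And>n. continuous_on H (F n)" and F_lim: "\<And>x. x \<in> H \<Longrightarrow> (\<lambda>n. F n x) \<longlonglongrightarrow> f x"
    using assms unfolding baire_one_on_def by blast
  define good where "good y d n \<longleftrightarrow> real n \<le> 1 / d \<and>
      (\<forall>z\<in>H. dist y z \<le> sqrt d \<longrightarrow> norm (F n y - F n z) \<le> 1 / Suc n)" for y d n
  \<comment> \<open>For large \<open>d\<close> there may be no good index, and then \<open>v y d\<close> is an arbitrary \<open>F n y\<close>: the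
    convergence to \<open>f a\<close> only concerns small \<open>d\<close>, and the other estimates hold for any value.\<close>
  define v where "v y d = F (GREATEST n. good y d n) y" for y d
  \<comment> \<open>Pointwise convergence gives no control on \<open>v y d - f y\<close>. Comparing it with the variation
    of \<open>f\<close> repairs this where \<open>f\<close> is well behaved.\<close>
  define w where "w y d = (if \<forall>z\<in>H. dist y z \<le> sqrt d \<longrightarrow>
      2 * norm (f z - f y) < norm (v y d - f y) then f y else v y d)" for y d
  define u where "u y d = (if norm (w y d) \<le> 1 / sqrt (sqrt d) then w y d else 0)" for y d
  \<comment> \<open>The correction is harmless: if \<open>v y d\<close> is more than twice as far from \<open>f y\<close> as
    \<open>f a\<close> is, then \<open>f a\<close> is nearer to \<open>f y\<close> than to \<open>v y d\<close>.\<close>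
  have w_v: "norm (w y d - f a) \<le> norm (v y d - f a)" if "a \<in> H" "dist y a \<le> sqrt d" for y d a
  proof (cases "\<forall>z\<in>H. dist y z \<le> sqrt d \<longrightarrow> 2 * norm (f z - f y) < norm (v y d - f y)")
    case True
    then have "2 * norm (f a - f y) < norm (v y d - f y)" using that by blast
    moreover have "norm (v y d - f y) \<le> norm (v y d - f a) + norm (f a - f y)"
      using norm_triangle_ineq[of "v y d - f a" "f a - f y"] by simp
    ultimately show ?thesis using True by (simp add: w_def norm_minus_commute)
  qed (auto simp: w_def)
  have "norm (u y d) \<le> 1 / sqrt (sqrt d)" if "d > 0" for y d
    using that by (simp add: u_def)
  moreover have "eventually (\<lambda>d. \<forall>y\<in>H. dist y a \<le> sqrt d \<longrightarrow> norm (u y d - f a) \<le> e) (at_right 0)"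
    if a: "a \<in> H" and e: "e > 0" for a e
  proof -
    \<comment> \<open>The fixed index \<open>m\<close> is admissible for all small \<open>d\<close>, hence the selected index is at
      least \<open>m\<close>.\<close>
    obtain n1 where n1: "\<And>n. n \<ge> n1 \<Longrightarrow> norm (F n a - f a) < e / 2"
      using LIMSEQ_D[OF F_lim[OF a], of "e / 2"] e by auto
    obtain n2 where n2: "1 / real (Suc n2) < e / 2" using e nat_approx_posE[of "e/2"] by auto
    define m where "m = max n1 n2"
    obtain \<eta> where \<eta>: "\<eta> > 0" "\<And>z. z \<in> H \<Longrightarrow> dist z a < \<eta> \<Longrightarrow> dist (F m z) (F m a) < 1 / (2 * Suc m)"
      using F_cont[of m] a unfolding continuous_on_iff
      by (metis zero_less_divide_1_iff of_nat_0_less_iff zero_less_Suc mult_pos_pos zero_less_numeral)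
    have "((\<lambda>d. 2 * sqrt d) \<longlongrightarrow> 2 * sqrt 0) (at_right 0)"
      by (intro tendsto_intros)
    then have "eventually (\<lambda>d. 2 * sqrt d < \<eta>) (at_right 0)"
      using \<eta>(1) by (intro order_tendstoD) auto
    moreover have "((\<lambda>d. real m * d) \<longlongrightarrow> real m * 0) (at_right 0)"
      by (intro tendsto_intros)
    then have "eventually (\<lambda>d. real m * d < 1) (at_right 0)"
      by (intro order_tendstoD) auto
    moreover have "((\<lambda>d. (norm (f a) + e) * sqrt (sqrt d)) \<longlongrightarrow> (norm (f a) + e) * sqrt (sqrt 0)) (at_right 0)"
      by (intro tendsto_intros)
    then have "eventually (\<lambda>d. (norm (f a) + e) * sqrt (sqrt d) < 1) (at_right 0)"
      by (intro order_tendstoD) auto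
    ultimately show ?thesis using eventually_at_right_less[of 0]
    proof eventually_elim
      case (elim d)
      show ?case
      proof (intro ballI impI)
        fix y assume y: "y \<in> H" "dist y a \<le> sqrt d"
        define n where "n = (GREATEST n. good y d n)"
        have "good y d m" unfolding good_def
        proof (intro conjI ballI impI)
          show "real m \<le> 1 / d" using elim by (simp add: field_simps)
          fix z assume z: "z \<in> H" "dist y z \<le> sqrt d"
          have "dist z a < \<eta>" "dist y a < \<eta>"
            using elim(1) real_sqrt_gt_zero[OF elim(4)] y z dist_triangle[of z a y]
            by (simp_all only: dist_commute)
          then have "dist (F m y) (F m z) < 1 / (2 * Suc m) + 1 / (2 * Suc m)"
            using \<eta>(2)[OF y(1)] \<eta>(2)[OF z(1)] dist_triangle2[of "F m y" "F m z" "F m a"]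
            by linarith
          then show "norm (F m y - F m z) \<le> 1 / Suc m" by (simp add: dist_norm field_simps)
        qed
        moreover have "k \<le> nat \<lfloor>1 / d\<rfloor>" if "good y d k" for k
          using that unfolding good_def by (simp add: le_nat_floor)
        ultimately have n: "good y d n" "m \<le> n" unfolding n_def
          by (blast intro: GreatestI_nat, blast intro: Greatest_le_nat)
        have "norm (F n y - F n a) \<le> 1 / Suc n" using n(1) a y by (simp add: good_def)
        also have "\<dots> \<le> 1 / Suc n2" using n(2) by (simp add: m_def field_simps)
        finally have "norm (F n y - F n a) < e / 2" using n2 by simp
        moreover have "norm (F n a - f a) < e / 2" using n1 n(2) by (simp add: m_def)
        ultimately have "norm (v y d - f a) \<le> e"
          using norm_triangle_ineq[of "F n y - F n a" "F n a - f a"] by (simp add: v_def n_def)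
        then have w: "norm (w y d - f a) \<le> e" using w_v[OF a y(2)] by linarith
        then have "norm (w y d) \<le> norm (f a) + e"
          using norm_triangle_sub[of "w y d" "f a"] by linarith
        also have "\<dots> \<le> 1 / sqrt (sqrt d)" using elim by (simp add: field_simps)
        finally show "norm (u y d - f a) \<le> e" using w by (simp add: u_def)
      qed
    qed
  qed
  moreover have "norm (u y d - b) \<le> 5 * M"
    if y: "y \<in> H" and d: "d > 0" and M: "\<forall>z\<in>H. dist y z \<le> sqrt d \<longrightarrow> norm (f z - b) \<le> M"
      and small: "5 * M + norm b \<le> 1 / sqrt (sqrt d)" for y d b M
  proof -
    \<comment> \<open>If the correction is made, \<open>z = y\<close> works; otherwise a point \<open>z\<close> that prevents it
      does.\<close>
    have "\<exists>z\<in>H. dist y z \<le> sqrt d \<and> norm (w y d - f y) \<le> 2 * norm (f z - f y)"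
    proof (cases "\<forall>z\<in>H. dist y z \<le> sqrt d \<longrightarrow> 2 * norm (f z - f y) < norm (v y d - f y)")
      case True
      then have "w y d = f y" unfolding w_def by (rule if_P)
      then show ?thesis using y d by (intro bexI[of _ y]) simp_all
    next
      case False
      then have "w y d = v y d" unfolding w_def by (rule if_not_P)
      then show ?thesis using False by (metis not_less)
    qed
    then obtain z where z: "z \<in> H" "dist y z \<le> sqrt d" "norm (w y d - f y) \<le> 2 * norm (f z - f y)"
      by blast
    have fy: "norm (f y - b) \<le> M" using M y d by simp
    have "norm (f z - f y) \<le> norm (f z - b) + norm (f y - b)"
      by (metis norm_triangle_sub dist_norm dist_triangle2)
    also have "\<dots> \<le> 2 * M" using M z(1,2) fy by fastforce
    finally have "norm (w y d - b) \<le> 5 * M"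
      using z(3) fy norm_triangle_ineq[of "w y d - f y" "f y - b"] by simp
    moreover have "norm (w y d) \<le> norm (w y d - b) + norm b"
      using norm_triangle_ineq[of "w y d - b" b] by simp
    ultimately show ?thesis using small by (simp add: u_def)
  qed
  ultimately show thesis by (rule that)
qed

section \<open>The extension\<close>

text \<open>
  Each \<open>p \<notin> H\<close> gets the value \<open>u (\<pi> p) d(p)\<close>, where \<open>\<pi> p\<close> is an almost nearest point
  of \<open>H\<close>, and these are averaged over the cover of the complement by balls of a quarter of the
  distance to \<open>H\<close>. On such a ball the distance to \<open>H\<close> changes by a factor of at most
  \<open>4/3\<close>. Bounds common to all values in use pass to the average since norm balls are
  convex.
\<close>

lemma whitney_average:
  fixes H :: "'a::metric_space set" and u :: "'a \<Rightarrow> real \<Rightarrow> 'z::real_normed_vector"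
  assumes "closed H" "H \<noteq> {}"
  obtains g :: "'a \<Rightarrow> 'z"
  where "continuous_on (- H) g"
    "\<And>x b R. x \<notin> H \<Longrightarrow>
       \<forall>y\<in>H. \<forall>d. infdist x H / 2 \<le> d \<longrightarrow> d \<le> 2 * infdist x H \<longrightarrow>
          dist x y \<le> 3 * infdist x H \<longrightarrow> norm (u y d - b) \<le> R \<Longrightarrow>
       norm (g x - b) \<le> R"
proof -
  have pos: "infdist x H > 0" if "x \<notin> H" for x
    using infdist_pos_not_in_closed[OF assms that] .
  have "\<exists>y\<in>H. dist x y < 2 * infdist x H" if "x \<notin> H" for x
    using pos[OF that] by (auto intro: infdist_lessE[OF _ assms(2), of x "2 * infdist x H"])
  then obtain \<pi> where \<pi>: "\<And>x. x \<notin> H \<Longrightarrow> \<pi> x \<in> H" "\<And>x. x \<notin> H \<Longrightarrow> dist x (\<pi> x) < 2 * infdist x H"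
    by metis
  define U where "U x = (if x \<in> H then {} else ball x (infdist x H / 4))" for x
  have U_pos: "infdist x H > 0" and U_H: "x \<notin> H" and U_p: "p \<notin> H"
    and U_le: "infdist x H / 2 \<le> infdist p H" "infdist p H \<le> 2 * infdist x H"
    and U_dist: "dist x (\<pi> p) \<le> 3 * infdist x H"
    if "x \<in> U p" for x p
  proof -
    show p: "p \<notin> H" using that by (auto simp: U_def split: if_splits)
    have xp: "dist x p < infdist p H / 4" using that by (auto simp: U_def dist_commute split: if_splits)
    have *: "infdist x H \<le> infdist p H + dist x p" "infdist p H \<le> infdist x H + dist x p"
      using infdist_triangle[of x H p] infdist_triangle[of p H x] by (auto simp: dist_commute)
    show "infdist x H / 2 \<le> infdist p H" "infdist p H \<le> 2 * infdist x H" using xp * pos[OF p] by linarith+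
    show pos: "infdist x H > 0" using xp * pos[OF p] by linarith
    then show "x \<notin> H" by auto
    show "dist x (\<pi> p) \<le> 3 * infdist x H"
      using dist_triangle[of x "\<pi> p" p] \<pi>(2)[OF p] xp * by linarith
  qed
  have cover: "(\<Union>p. U p) = - H"
  proof
    show "(\<Union>p. U p) \<subseteq> - H" using U_H by blast
    have "x \<in> U x" if "x \<notin> H" for x using that pos by (simp add: U_def)
    then show "- H \<subseteq> (\<Union>p. U p)" by blast
  qed
  obtain g :: "'a \<Rightarrow> 'z" where g: "continuous_on (\<Union>p. U p) g"
    "\<And>x. x \<in> (\<Union>p. U p) \<Longrightarrow> g x \<in> convex hull ((\<lambda>p. u (\<pi> p) (infdist p H)) ` {p. x \<in> U p})"
    by (rule continuous_average[of U "\<lambda>p. u (\<pi> p) (infdist p H)"]) (auto simp: U_def)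
  show thesis
  proof (rule that)
    show "continuous_on (- H) g" using g(1) cover by simp
    show "norm (g x - b) \<le> R"
      if x: "x \<notin> H" and R: "\<forall>y\<in>H. \<forall>d. infdist x H / 2 \<le> d \<longrightarrow> d \<le> 2 * infdist x H \<longrightarrow>
          dist x y \<le> 3 * infdist x H \<longrightarrow> norm (u y d - b) \<le> R" for x b R
    proof -
      have "(\<lambda>p. u (\<pi> p) (infdist p H)) ` {p. x \<in> U p} \<subseteq> cball b R"
        using R \<pi>(1) U_p U_le U_dist by (auto simp: dist_norm norm_minus_commute)
      then have "convex hull ((\<lambda>p. u (\<pi> p) (infdist p H)) ` {p. x \<in> U p}) \<subseteq> cball b R"
        by (intro hull_minimal convex_cball)
      then have "g x \<in> cball b R" using g(2) x cover by blast
      then show ?thesis by (simp add: dist_norm norm_minus_commute)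
    qed
  qed
qed

theorem theorem1p1:
  fixes H :: "'a::metric_space set"
    and f :: "'a \<Rightarrow> 'z::real_normed_vector"
  assumes "closed H"
    and "baire_one_on H f"
  shows "\<exists>g :: 'a \<Rightarrow> 'z. continuous_on (- H) g \<and>
    (\<forall>a \<in> frontier H.
       ((\<lambda>x. norm (g x - f a) * (infdist x H / dist x a)) \<longlongrightarrow> 0) (at a within - H)) \<and>
    (\<forall>a \<in> frontier H. continuous (at a within H) f \<longrightarrow>
       (g \<longlongrightarrow> f a) (at a within - H)) \<and>
    (\<forall>a \<in> H. \<forall>r :: ereal. 0 < r \<longrightarrow> bounded (f ` (eball a (12 * r) \<inter> H)) \<longrightarrow>
       bounded (g ` (eball a r - H)))"
proof (cases "H = {}")
  case True
  then show ?thesis by (intro exI[of _ "\<lambda>_. 0"]) simp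
next
  case False
  obtain u :: "'a \<Rightarrow> real \<Rightarrow> 'z" where
    u_bound: "\<And>y d. d > 0 \<Longrightarrow> norm (u y d) \<le> 1 / sqrt (sqrt d)" and
    u_near: "\<And>a e. a \<in> H \<Longrightarrow> e > 0 \<Longrightarrow>
       eventually (\<lambda>d. \<forall>y\<in>H. dist y a \<le> sqrt d \<longrightarrow> norm (u y d - f a) \<le> e) (at_right 0)" and
    u_osc: "\<And>y d b M. y \<in> H \<Longrightarrow> d > 0 \<Longrightarrow>
       \<forall>z\<in>H. dist y z \<le> sqrt d \<longrightarrow> norm (f z - b) \<le> M \<Longrightarrow>
       5 * M + norm b \<le> 1 / sqrt (sqrt d) \<Longrightarrow> norm (u y d - b) \<le> 5 * M"
    by (rule baire_one_scale_approximation[OF assms(2)]) (rule that)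
  obtain g :: "'a \<Rightarrow> 'z" where g_cont: "continuous_on (- H) g" and
    g_avg: "\<And>x b R. x \<notin> H \<Longrightarrow>
       \<forall>y\<in>H. \<forall>d. infdist x H / 2 \<le> d \<longrightarrow> d \<le> 2 * infdist x H \<longrightarrow>
          dist x y \<le> 3 * infdist x H \<longrightarrow> norm (u y d - b) \<le> R \<Longrightarrow>
       norm (g x - b) \<le> R"
    by (rule whitney_average[OF assms(1) False, of u]) (rule that)
  have pos: "infdist x H > 0" if "x \<notin> H" for x
    using infdist_pos_not_in_closed[OF assms(1) False that] .

  have NT: "((\<lambda>x. norm (g x - f a) * (infdist x H / dist x a)) \<longlongrightarrow> 0) (at a within - H)"
    if a: "a \<in> H" for a
  proof (rule tendstoI)
    fix e :: real assume "e > 0"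
    define e' where "e' = e / 2"
    have e': "e' > 0" "e' < e" using \<open>e > 0\<close> by (auto simp: e'_def)
    have "((\<lambda>d. 8 * sqrt (sqrt d) + 8 * norm (f a) * sqrt d) \<longlongrightarrow>
        8 * sqrt (sqrt 0) + 8 * norm (f a) * sqrt 0) (at_right 0)"
      by (intro tendsto_intros)
    then have "eventually (\<lambda>d. 8 * sqrt (sqrt d) + 8 * norm (f a) * sqrt d < e') (at_right 0)"
      using e' by (intro order_tendstoD) auto
    with u_near[OF a e'(1)] have "eventually (\<lambda>d. (\<forall>y\<in>H. dist y a \<le> sqrt d \<longrightarrow> norm (u y d - f a) \<le> e')
        \<and> 8 * sqrt (sqrt d) + 8 * norm (f a) * sqrt d < e') (at_right 0)"
      by (rule eventually_conj)
    then obtain \<delta> where \<delta>: "\<delta> > 0"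
      "\<And>d y. 0 < d \<Longrightarrow> d < \<delta> \<Longrightarrow> y \<in> H \<Longrightarrow> dist y a \<le> sqrt d \<Longrightarrow> norm (u y d - f a) \<le> e'"
      "\<And>d. 0 < d \<Longrightarrow> d < \<delta> \<Longrightarrow> 8 * sqrt (sqrt d) + 8 * norm (f a) * sqrt d < e'"
      unfolding eventually_at_right_field by blast
    have "norm (g x - f a) * (infdist x H / dist x a) < e" if x: "x \<notin> H" "dist x a < \<delta> / 2" for x
    proof -
      define \<rho> \<tau> where "\<rho> = dist x a" and "\<tau> = infdist x H"
      have \<tau>: "0 < \<tau>" "\<tau> \<le> \<rho>" using pos[OF x(1)] infdist_le[OF a] by (auto simp: \<rho>_def \<tau>_def)
      have "norm (g x - f a) \<le> e' * \<rho> / \<tau>"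
      proof (rule g_avg[OF x(1)], fold \<tau>_def, intro ballI allI impI)
        fix y d assume y: "y \<in> H" "\<tau> / 2 \<le> d" "d \<le> 2 * \<tau>" "dist x y \<le> 3 * \<tau>"
        have d: "0 < d" "d < \<delta>" using y \<tau> x(2) by (auto simp: \<rho>_def)
        show "norm (u y d - f a) \<le> e' * \<rho> / \<tau>"
        proof (cases "dist y a \<le> sqrt d")
          case True
          then have "norm (u y d - f a) \<le> e' * 1" using \<delta>(2) d y by simp
          also have "\<dots> \<le> e' * (\<rho> / \<tau>)" using \<tau> e' by (intro mult_left_mono) auto
          finally show ?thesis by simp
        next
          case far: False
          \<comment> \<open>Here \<open>dist x a\<close> exceeds \<open>sqrt d / 4\<close>, whereas \<open>infdist x H \<le> 2 d\<close>. In powers of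
            \<open>t\<close>, the norm is at most \<open>1/t\<close> up to a constant and the ratio is \<open>O(t\<^sup>2)\<close>.\<close>
          define t where "t = sqrt (sqrt d)"
          have t: "t > 0" "sqrt d = t * t" "d = t * t * (t * t)" using d by (auto simp: t_def)
          have "dist y a \<le> 4 * \<rho>"
            using dist_triangle[of y a x] y \<tau> by (auto simp: dist_commute \<rho>_def)
          then have \<rho>: "t * t < 4 * \<rho>" using far t by simp
          have "norm (u y d - f a) \<le> 1 / t + norm (f a)"
            using u_bound[OF d(1), of y] norm_triangle_ineq4[of "u y d" "f a"] by (simp add: t_def)
          then have "norm (u y d - f a) * \<tau> \<le> (1 / t + norm (f a)) * (2 * d)"
            using \<tau> y t by (intro mult_mono) auto
          also have "\<dots> = (8 * t + 8 * norm (f a) * (t * t)) * (t * t / 4)"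
            using t(1) unfolding t(3) by (simp add: field_simps)
          also have "\<dots> \<le> e' * \<rho>"
          proof (rule mult_mono)
            show "8 * t + 8 * norm (f a) * (t * t) \<le> e'"
              using \<delta>(3)[OF d] unfolding t(2) by (simp add: t_def[symmetric] flip: t(2))
            show "t * t / 4 \<le> \<rho>" using \<rho> by simp
          qed (use e' in auto)
          finally show ?thesis using \<tau> by (simp add: field_simps)
        qed
      qed
      then have "norm (g x - f a) * (\<tau> / \<rho>) \<le> (e' * \<rho> / \<tau>) * (\<tau> / \<rho>)"
        using \<tau> by (intro mult_right_mono) auto
      also have "\<dots> = e'" using \<tau> by simp
      finally show ?thesis using e' by (simp add: \<rho>_def \<tau>_def)
    qed
    then show "eventually (\<lambda>x. dist (norm (g x - f a) * (infdist x H / dist x a)) 0 < e) (at a within - H)"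
      using \<delta>(1) unfolding eventually_at
      by (intro exI[of _ "\<delta> / 2"]) (auto simp: abs_mult abs_of_nonneg[OF infdist_nonneg])
  qed

  have C: "(g \<longlongrightarrow> f a) (at a within - H)" if a: "a \<in> H" and cont: "continuous (at a within H) f" for a
  proof (rule tendstoI)
    fix e :: real assume e: "e > 0"
    obtain \<eta> where \<eta>: "\<eta> > 0" "\<And>z. z \<in> H \<Longrightarrow> dist z a < \<eta> \<Longrightarrow> norm (f z - f a) \<le> e / 10"
      using cont e unfolding continuous_within_eps_delta
      by (metis dist_norm less_imp_le zero_less_divide_iff zero_less_numeral)
    have "((\<lambda>d. sqrt d) \<longlongrightarrow> sqrt 0) (at_right 0)" by (intro tendsto_intros)
    then have "eventually (\<lambda>d. sqrt d < \<eta> / 2) (at_right 0)"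
      using \<eta> by (intro order_tendstoD) auto
    moreover have "((\<lambda>d. (e / 2 + norm (f a)) * sqrt (sqrt d)) \<longlongrightarrow> (e / 2 + norm (f a)) * sqrt (sqrt 0)) (at_right 0)"
      by (intro tendsto_intros)
    then have "eventually (\<lambda>d. (e / 2 + norm (f a)) * sqrt (sqrt d) < 1) (at_right 0)"
      by (intro order_tendstoD) auto
    ultimately have "eventually (\<lambda>d. sqrt d < \<eta> / 2 \<and> (e / 2 + norm (f a)) * sqrt (sqrt d) < 1) (at_right 0)"
      by (rule eventually_conj)
    then obtain \<delta> where \<delta>: "\<delta> > 0" "\<And>d. 0 < d \<Longrightarrow> d < \<delta> \<Longrightarrow> sqrt d < \<eta> / 2"
      "\<And>d. 0 < d \<Longrightarrow> d < \<delta> \<Longrightarrow> (e / 2 + norm (f a)) * sqrt (sqrt d) < 1"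
      unfolding eventually_at_right_field by blast
    have "norm (g x - f a) < e" if x: "x \<notin> H" "dist x a < min (\<delta> / 2) (\<eta> / 8)" for x
    proof -
      have \<tau>: "0 < infdist x H" "infdist x H \<le> dist x a" using pos[OF x(1)] infdist_le[OF a] by auto
      have "norm (g x - f a) \<le> 5 * (e / 10)"
      proof (rule g_avg[OF x(1)], intro ballI allI impI)
        fix y d assume y: "y \<in> H" "infdist x H / 2 \<le> d" "d \<le> 2 * infdist x H" "dist x y \<le> 3 * infdist x H"
        have d: "0 < d" "d < \<delta>" using y \<tau> x(2) by auto
        have ya: "dist y a < \<eta> / 2" using dist_triangle3[of y a x] y \<tau> x(2) by auto
        show "norm (u y d - f a) \<le> 5 * (e / 10)"
        proof (rule u_osc[OF y(1) d(1)], intro ballI impI)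
          fix z assume z: "z \<in> H" "dist y z \<le> sqrt d"
          show "norm (f z - f a) \<le> e / 10"
            using \<eta>(2)[OF z(1)] dist_triangle3[of z a y] z(2) ya \<delta>(2)[OF d] by simp
        next
          show "5 * (e / 10) + norm (f a) \<le> 1 / sqrt (sqrt d)"
            using \<delta>(3)[OF d] d by (simp add: field_simps)
        qed
      qed
      then show ?thesis using e by simp
    qed
    then show "eventually (\<lambda>x. dist (g x) (f a) < e) (at a within - H)"
      using \<delta>(1) \<eta>(1) unfolding eventually_at
      by (intro exI[of _ "min (\<delta> / 2) (\<eta> / 8)"]) (auto simp: dist_norm)
  qed

  have B: "bounded (g ` (eball a r - H))"
    if a: "a \<in> H" and r: "0 < r" and bdd: "bounded (f ` (eball a (12 * r) \<inter> H))" for a and r :: ereal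
  proof -
    obtain M where M: "\<And>z. z \<in> H \<Longrightarrow> ereal (dist a z) < 12 * r \<Longrightarrow> norm (f z) \<le> M"
      using bdd unfolding bounded_iff by (auto simp: eball_def)
    \<comment> \<open>At scales too large for the third property of \<open>u\<close>, the bound of its first property is
      already below \<open>5 * M\<close>.\<close>
    have u_le: "norm (u y d) \<le> 5 * M" if "y \<in> H" "d > 0"
      and ball: "\<And>z. z \<in> H \<Longrightarrow> dist y z \<le> sqrt d \<Longrightarrow> ereal (dist a z) < 12 * r" for y d
    proof (cases "5 * M \<le> 1 / sqrt (sqrt d)")
      case True
      then show ?thesis using u_osc[of y d 0 M] that M by simp
    next
      case False
      then show ?thesis using u_bound[OF that(2), of y] by linarith
    qed
    have "\<exists>C. \<forall>x. x \<notin> H \<longrightarrow> ereal (dist a x) < r \<longrightarrow> norm (g x) \<le> C"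
    proof (cases r)
      case PInf
      have "norm (g x) \<le> 5 * M" if x: "x \<notin> H" for x
        using g_avg[OF x, of 0 "5 * M"] u_le pos[OF x] PInf by force
      then show ?thesis by blast
    next
      case (real s)
      then have s: "s > 0" using r by simp
      define C where "C = 1 / sqrt (8 * s)"
      have "norm (g x) \<le> max (5 * M) C" if x: "x \<notin> H" "dist a x < s" for x
      proof -
        have \<tau>: "0 < infdist x H" "infdist x H < s"
          using pos[OF x(1)] infdist_le[OF a, of x] x(2) by (auto simp: dist_commute)
        have "norm (g x - 0) \<le> max (5 * M) C"
        proof (rule g_avg[OF x(1)], intro ballI allI impI)
          fix y d assume y: "y \<in> H" "infdist x H / 2 \<le> d" "d \<le> 2 * infdist x H" "dist x y \<le> 3 * infdist x H"
          have d: "d > 0" using y \<tau> by linarith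
          have ya: "dist a y < 4 * s" using dist_triangle[of a y x] y x \<tau> by linarith
          \<comment> \<open>If \<open>sqrt d \<le> 8 s\<close>, the points of \<open>H\<close> that influence \<open>u y d\<close> lie within
            \<open>4 s + 8 s = 12 s\<close> of \<open>a\<close>; larger scales are covered by the a priori norm bound.\<close>
          show "norm (u y d - 0) \<le> max (5 * M) C"
          proof (cases "sqrt d \<le> 8 * s")
            case True
            have "ereal (dist a z) < 12 * r" if "dist y z \<le> sqrt d" for z
              using dist_triangle[of a z y] ya that True by (simp add: real)
            then have "norm (u y d) \<le> 5 * M" using u_le y(1) d by blast
            then show ?thesis by simp
          next
            case False
            then have "1 / sqrt (sqrt d) \<le> C" unfolding C_def
              using s by (intro frac_le real_sqrt_le_mono real_sqrt_gt_zero) auto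
            then have "norm (u y d) \<le> C" using u_bound[OF d, of y] by linarith
            then show ?thesis by simp
          qed
        qed
        then show ?thesis by simp
      qed
      then show ?thesis using real by auto
    qed (use r in auto)
    then show ?thesis unfolding bounded_iff by (auto simp: eball_def)
  qed

  have "frontier H \<subseteq> H" using assms(1) by (rule frontier_subset_closed)
  then show ?thesis using g_cont NT C B by blast
qed

end
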